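(* For $p \in \mathbb{R}^+$ and $x \in (0,1)$ let $$\varphi_p(x) = \frac{1}{x^2} - \frac{e^{-x}}{(1-e^{-x})^2} - p,$$ and let $$A = \frac{e^2 - 3e + 1}{e^2 - 2e + 1} = 0.079326\ldots, \qquad B = \frac{1}{12} = 0.083333\ldots.$$ Then the following hold. (i) If $p \in (0, A]$, then for all $x \in (0,1)$: $$\frac{e^{-x}}{(1-e^{-x})^2} < \frac{1}{x^2} - A \leq \frac{1}{x^2} - p.$$ (ii) If $p \in (A, B)$, then the equation $\varphi_p(x) = 0$ has a unique solution $x_0^{(p)}$ in $(0,1)$, and $$x \in \left(0, x_0^{(p)}\right) \Rightarrow \frac{e^{-x}}{(1-e^{-x})^2} < \frac{1}{x^2} - p, \qquad x \in \left(x_0^{(p)}, 1\right) \Rightarrow \frac{e^{-x}}{(1-e^{-x})^2} > \frac{1}{x^2} - p.$$ (iii) If $p \in [B, \infty)$, then for all $x \in (0,1)$: $$\frac{e^{-x}}{(1-e^{-x})^2} > \frac{1}{x^2} - B \geq \frac{1}{x^2} - p.$$ (iv) The equation $\varphi_p(0+) = -\varphi_p(1-)$ has exactly one solution with respect to the parameter $p \in (A,B)$, namely $$p_0 = \frac{13e^2 - 38e + 13}{24e^2 - 48e + 24} = 0.081329\ldots,$$ and for the value $$d_0 = \varphi_{p_0}(0+) = |\varphi_{p_0}(1-)| = \frac{-11e^2 + 34e - 11}{24e^2 - 48e + 24} = 0.0020034\ldots$$ it holds that $$d_0 = \inf_{p \in \mathbb{R}^+} \sup_{x \in (0,1)} |\varphi_p(x)|.$$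 (v) The minimax approximant of the family $(\varphi_p)_{p\in\mathbb{R}^+}$ on $(0,1)$ is the function obtained for $p = p_0$, namely $$\varphi_{p_0}(x) = \frac{1}{x^2} - \frac{e^{-x}}{(1-e^{-x})^2} - \frac{13e^2 - 38e + 13}{24e^2 - 48e + 24}.$$
   Context: $\mathbb{R}^+ = (0,\infty)$; $\varphi_p(0+)$ and $\varphi_p(1-)$ denote the one-sided limits $\lim_{x\to 0+}\varphi_p(x)$ and $\lim_{x\to 1-}\varphi_p(x)$, which exist and are finite. For a family of functions $\varphi_p$, $p \in \mathbb{R}^+$, on an interval $(a,b)$, put $d(p) = \sup_{x\in(a,b)}|\varphi_p(x)|$. If the infimum of $d(p)$ over $p \in \mathbb{R}^+$ is attained at a unique value $p = p_0$, the function $\varphi_{p_0}$ is called the minimax approximant of the family on $(a,b)$. Decimals followed by dots are truncated decimal expansions. *)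

theory Defs
  imports "HOL-Analysis.Analysis"
begin

text \<open>
  A family of functions is a map \<open>\<phi> :: real \<Rightarrow> real \<Rightarrow> real\<close>, the parameter coming first; only
  parameters \<open>p > 0\<close> and arguments in the open interval from \<open>a\<close> to \<open>b\<close> matter.
  Suprema and infima are taken in the extended reals, so that an unbounded member of a family
  has \<open>sup_dev = \<infinity>\<close>, whereas the real-valued supremum of an unbounded set is unspecified.
\<close>

definition sup_dev :: "(real \<Rightarrow> real \<Rightarrow> real) \<Rightarrow> real \<Rightarrow> real \<Rightarrow> real \<Rightarrow> ereal" where
  "sup_dev \<phi> a b p = (SUP x\<in>{a<..<b}. ereal \<bar>\<phi> p x\<bar>)"

definition inf_sup_dev :: "(real \<Rightarrow> real \<Rightarrow> real) \<Rightarrow> real \<Rightarrow> real \<Rightarrow> ereal" where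
  "inf_sup_dev \<phi> a b = (INF p\<in>{0<..}. sup_dev \<phi> a b p)"

definition is_minimax_parameter ::
    "(real \<Rightarrow> real \<Rightarrow> real) \<Rightarrow> real \<Rightarrow> real \<Rightarrow> real \<Rightarrow> bool" where
  "is_minimax_parameter \<phi> a b p\<^sub>0 \<longleftrightarrow>
     p\<^sub>0 > 0 \<and> sup_dev \<phi> a b p\<^sub>0 = inf_sup_dev \<phi> a b \<and>
     (\<forall>p>0. sup_dev \<phi> a b p = inf_sup_dev \<phi> a b \<longrightarrow> p = p\<^sub>0)"

definition is_minimax_approximant ::
    "(real \<Rightarrow> real \<Rightarrow> real) \<Rightarrow> real \<Rightarrow> real \<Rightarrow> (real \<Rightarrow> real) \<Rightarrow> bool" where
  "is_minimax_approximant \<phi> a b g \<longleftrightarrow>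
     (\<exists>p\<^sub>0. is_minimax_parameter \<phi> a b p\<^sub>0 \<and> (\<forall>x\<in>{a<..<b}. g x = \<phi> p\<^sub>0 x))"

definition phi :: "real \<Rightarrow> real \<Rightarrow> real" where
  "phi p x = 1 / x\<^sup>2 - exp (- x) / (1 - exp (- x))\<^sup>2 - p"

definition const_A :: real where
  "const_A = ((exp 1)\<^sup>2 - 3 * exp 1 + 1) / ((exp 1)\<^sup>2 - 2 * exp 1 + 1)"

definition const_B :: real where
  "const_B = 1 / 12"

definition const_p0 :: real where
  "const_p0 = (13 * (exp 1)\<^sup>2 - 38 * exp 1 + 13) / (24 * (exp 1)\<^sup>2 - 48 * exp 1 + 24)"

definition const_d0 :: real where
  "const_d0 = (- 11 * (exp 1)\<^sup>2 + 34 * exp 1 - 11) / (24 * (exp 1)\<^sup>2 - 48 * exp 1 + 24)"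

end

theory Submission
  imports Defs "HOL-Real_Asymp.Real_Asymp"
begin

text \<open>
  The members of the family differ only by a constant, so everything is decided by the single
  function \<open>h = phi 0\<close>. It is strictly decreasing on the positive half-line
  (\<open>phi_strict_antimono\<close>), it tends to \<open>B = 1/12\<close> at \<open>0\<close>, and its value at \<open>1\<close> is \<open>A\<close>. Hence
  \<open>A < h x < B\<close> on the unit interval, which gives both one-sided bounds, and for \<open>A < p < B\<close> the
  intermediate value theorem and monotonicity give a single change of sign.

  Monotonicity comes from Lazarevic's inequality \<open>cosh t < (sinh t / t) ^ 3\<close>
  (\<open>lazarevic\<close>): since \<open>exp (- x) / (1 - exp (- x))\<^sup>2 = 1 / (2 * sinh (x / 2))\<^sup>2\<close>, this inequality
  at \<open>t = x / 2\<close> is exactly the statement that \<open>h\<close> has a negative derivative at \<open>x\<close>.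

  As \<open>h\<close> stays between its two boundary limits, the deviation of \<open>h - p\<close> is
  \<open>max \<bar>B - p\<bar> \<bar>A - p\<bar>\<close> (\<open>sup_dev_phi\<close>). This is at least \<open>(B - A) / 2\<close>, with equality only at the
  midpoint \<open>p = (A + B) / 2\<close>. That midpoint is \<open>p\<^sub>0\<close>, and the minimal deviation is \<open>d\<^sub>0\<close>.
\<close>

section \<open>Lazarevic's inequality\<close>

text \<open>
  In terms of \<open>v = cosh t powr (1/3)\<close> the claim is that \<open>sinh t / v - t\<close>, which vanishes at \<open>0\<close>, is
  positive. With \<open>u = v\<^sup>2\<close> and \<open>sinh\<^sup>2 t = u ^ 3 - 1\<close>, its derivative becomes
  \<open>(u - 1)\<^sup>2 * (2 * u + 1) / (3 * u\<^sup>2)\<close>, which is positive because \<open>u > 1\<close>.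
\<close>

lemma lazarevic:
  fixes t :: real
  assumes "t > 0"
  shows "t ^ 3 * cosh t < sinh t ^ 3"
proof -
  define v where "v = (\<lambda>s::real. cosh s powr (1/3))"
  have v_pos: "v s > 0" for s
    by (simp add: v_def)
  have v_cube: "v s ^ 3 = cosh s" for s
  proof -
    have "v s ^ 3 = v s powr 3"
      using v_pos[of s] by simp
    then show ?thesis by (simp add: v_def powr_powr)
  qed
  have deriv_v: "(v has_real_derivative sinh s / (3 * (v s)\<^sup>2)) (at s)" for s
  proof -
    have "cosh s powr (1/3 - 1) = v s / cosh s"
      unfolding v_def powr_diff by simp
    also have "\<dots> = 1 / (v s)\<^sup>2"
      using v_pos[of s] by (simp add: v_cube[of s, symmetric] power2_eq_square power3_eq_cube)
    finally have eq: "cosh s powr (1/3 - 1) = 1 / (v s)\<^sup>2" .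
    have "(v has_real_derivative 1/3 * cosh s powr (1/3 - 1) * sinh s) (at s)"
      unfolding v_def by (rule DERIV_fun_powr[where r = "1/3", simplified of_nat_1])
         (auto intro!: derivative_eq_intros)
    then show ?thesis unfolding eq by simp
  qed
  define f where "f = (\<lambda>s. sinh s / v s - s)"
  have deriv_f: "(f has_real_derivative
      ((v s)\<^sup>2 - 1)\<^sup>2 * (2 * (v s)\<^sup>2 + 1) / (3 * ((v s)\<^sup>2)\<^sup>2)) (at s)" for s
  proof -
    have vn: "v s \<noteq> 0" using v_pos[of s] by simp
    have "(f has_real_derivative
        (cosh s * v s - sinh s * (sinh s / (3 * (v s)\<^sup>2))) / (v s * v s) - 1) (at s)"
      unfolding f_def using vn by (auto intro!: derivative_eq_intros deriv_v)
    moreover have "(cosh s * v s - sinh s * (sinh s / (3 * (v s)\<^sup>2))) / (v s * v s) - 1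
        = (3 * cosh s * v s ^ 3 - (sinh s)\<^sup>2 - 3 * v s ^ 4) / (3 * v s ^ 4)"
      using vn by (simp add: field_simps power2_eq_square power3_eq_cube power4_eq_xxxx)
    moreover have "3 * cosh s * v s ^ 3 - (sinh s)\<^sup>2 - 3 * v s ^ 4
        = ((v s)\<^sup>2 - 1)\<^sup>2 * (2 * (v s)\<^sup>2 + 1)"
      unfolding sinh_square_eq v_cube[of s, symmetric] by algebra
    ultimately show ?thesis by (simp add: power_mult[symmetric])
  qed
  have "f 0 < f t"
  proof (rule DERIV_pos_imp_increasing_open[OF assms])
    fix s :: real
    assume "0 < s" "s < t"
    then have "cosh s > 1" by (simp add: cosh_real_strict_mono[of 0, simplified])
    then have "v s > 1" by (simp add: v_def)
    then have "(v s)\<^sup>2 > 1" by simp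
    then have "((v s)\<^sup>2 - 1)\<^sup>2 * (2 * (v s)\<^sup>2 + 1) / (3 * ((v s)\<^sup>2)\<^sup>2) > 0"
      using v_pos[of s] by (intro divide_pos_pos mult_pos_pos zero_less_power) auto
    then show "\<exists>y. (f has_real_derivative y) (at s) \<and> 0 < y"
      using deriv_f by blast
  qed (use deriv_f in \<open>auto intro!: continuous_at_imp_continuous_on DERIV_isCont\<close>)
  then have "t * v t < sinh t"
    using v_pos[of t] by (simp add: f_def field_simps)
  then have "(t * v t) ^ 3 < sinh t ^ 3"
    using assms v_pos[of t] by (intro power_strict_mono) auto
  then show ?thesis by (simp add: power_mult_distrib v_cube)
qed

section \<open>The family and its boundary values\<close>

lemma exp_quotient_eq_sinh:
  fixes x :: real
  shows "exp (- x) / (1 - exp (- x))\<^sup>2 = 1 / (2 * sinh (x / 2))\<^sup>2"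
proof -
  have "1 - exp (- x) = exp (- (x / 2)) * (2 * sinh (x / 2))"
    by (simp add: sinh_field_def algebra_simps flip: exp_add)
  moreover have "exp (- x) = (exp (- (x / 2)))\<^sup>2"
    by (simp flip: exp_double)
  ultimately show ?thesis
    by (simp add: power_mult_distrib)
qed

lemma phi_has_derivative:
  assumes "x > 0"
  shows "(phi p has_real_derivative
    cosh (x / 2) / (4 * sinh (x / 2) ^ 3) - 2 / x ^ 3) (at x)"
proof -
  have s: "sinh (x / 2) > 0" using assms by simp
  have eq: "phi p = (\<lambda>x. 1 / x\<^sup>2 - 1 / (2 * sinh (x / 2))\<^sup>2 - p)"
    by (rule ext) (simp only: phi_def exp_quotient_eq_sinh)
  show ?thesis
    unfolding eq using assms s
    by (auto intro!: derivative_eq_intros simp: field_simps power2_eq_square power3_eq_cube)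
qed

lemma phi_strict_antimono:
  assumes "0 < x" "x < y"
  shows "phi p y < phi p x"
proof (rule DERIV_neg_imp_decreasing[OF assms(2)])
  fix z :: real
  assume "x \<le> z" "z \<le> y"
  with assms have z: "z > 0" by simp
  then have "sinh (z / 2) > 0" by simp
  moreover have "(z / 2) ^ 3 * cosh (z / 2) < sinh (z / 2) ^ 3"
    using z by (intro lazarevic) simp
  ultimately have "cosh (z / 2) / (4 * sinh (z / 2) ^ 3) - 2 / z ^ 3 < 0"
    using z by (simp add: field_simps)
  then show "\<exists>d. (phi p has_real_derivative d) (at z) \<and> d < 0"
    using phi_has_derivative[OF z] by blast
qed

lemma phi_continuous_on: "S \<subseteq> {0<..} \<Longrightarrow> continuous_on S (phi p)"
  by (auto intro!: continuous_at_imp_continuous_on DERIV_isCont[OF phi_has_derivative])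

lemma phi_tendsto_0: "(phi p \<longlongrightarrow> const_B - p) (at_right 0)"
proof -
  have "((\<lambda>x::real. 1 / x\<^sup>2 - exp (- x) / (1 - exp (- x))\<^sup>2) \<longlongrightarrow> 1 / 12) (at_right 0)"
    by real_asymp
  then show ?thesis
    unfolding phi_def const_B_def by (intro tendsto_intros)
qed

lemma const_A_alt: "const_A = 1 - exp 1 / (exp 1 - 1)\<^sup>2"
proof -
  have "exp 1 - 1 \<noteq> (0::real)" by simp
  moreover have "(exp 1)\<^sup>2 - 2 * exp 1 + 1 = (exp 1 - 1 :: real)\<^sup>2"
    by (simp add: power2_eq_square algebra_simps)
  ultimately show ?thesis
    unfolding const_A_def by (simp add: divide_simps)
qed

lemma phi_at_1: "phi p 1 = const_A - p"
proof -
  have "exp (- 1) / (1 - exp (- 1))\<^sup>2 = exp 1 / (exp 1 - 1 :: real)\<^sup>2"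
    by (simp add: exp_minus divide_simps) (simp add: power2_eq_square algebra_simps)
  then show ?thesis by (simp add: phi_def const_A_alt)
qed

lemma phi_tendsto_1: "(phi p \<longlongrightarrow> const_A - p) (at_left 1)"
proof -
  have "isCont (phi p) 1"
    by (rule DERIV_isCont[OF phi_has_derivative]) simp
  then show ?thesis
    unfolding isCont_def phi_at_1 by (rule tendsto_mono[rotated]) (simp add: at_le)
qed

lemma phi_gt_at_1: "x \<in> {0<..<1} \<Longrightarrow> const_A - p < phi p x"
  using phi_strict_antimono[of x 1 p] by (simp add: phi_at_1)

text \<open>
  Passing to the limit in \<open>phi p x < phi p y\<close> only gives a weak inequality, so it is applied at the
  intermediate point \<open>x / 2\<close>.
\<close>

lemma phi_lt_at_0:
  assumes "0 < x"
  shows "phi p x < const_B - p"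
proof -
  have "eventually (\<lambda>y. phi p (x / 2) \<le> phi p y) (at_right 0)"
    unfolding eventually_at_right_field
    using assms phi_strict_antimono by (intro exI[of _ "x / 2"]) (auto intro!: less_imp_le)
  then have "phi p (x / 2) \<le> const_B - p"
    by (intro tendsto_lowerbound[OF phi_tendsto_0]) auto
  moreover have "phi p x < phi p (x / 2)"
    using assms by (intro phi_strict_antimono) auto
  ultimately show ?thesis by simp
qed

lemma phi_unique_zero:
  assumes "p \<in> {const_A<..<const_B}"
  shows "\<exists>!x. x \<in> {0<..<1} \<and> phi p x = 0"
proof -
  have "eventually (\<lambda>y. 0 < phi p y) (at_right 0)"
    using assms by (intro order_tendstoD[OF phi_tendsto_0]) auto
  then have "eventually (\<lambda>y. 0 < phi p y \<and> y \<in> {0<..<1}) (at_right 0)"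
    by (intro eventually_conj eventually_at_right_real) auto
  then obtain y where y: "0 < phi p y" "0 < y" "y < 1"
    using eventually_happens'[OF trivial_limit_at_right_real] by force
  have "phi p 1 < 0" using assms by (simp add: phi_at_1)
  moreover have "\<exists>x\<ge>y. x \<le> 1 \<and> phi p x = 0"
    using y \<open>phi p 1 < 0\<close> by (intro IVT2' phi_continuous_on) auto
  ultimately have "\<exists>x. x \<in> {0<..<1} \<and> phi p x = 0"
    using y by (metis greaterThanLessThan_iff less_irrefl order_less_le order_less_le_trans)
  moreover have "x = x'" if "x \<in> {0<..<1}" "x' \<in> {0<..<1}" "phi p x = 0" "phi p x' = 0" for x x'
    using that phi_strict_antimono[of x x' p] phi_strict_antimono[of x' x p]
    by (cases x x' rule: linorder_cases) auto
  ultimately show ?thesis by blast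
qed

section \<open>The minimax parameter\<close>

lemma midpoint: "const_p0 = (const_A + const_B) / 2" "const_d0 = (const_B - const_A) / 2"
proof -
  have "(exp 1)\<^sup>2 - 2 * exp 1 + 1 = (exp 1 - 1 :: real)\<^sup>2"
    by (simp add: power2_eq_square algebra_simps)
  then have D: "(exp 1)\<^sup>2 - 2 * exp 1 + 1 \<noteq> (0::real)" by simp
  have D': "24 * (exp 1)\<^sup>2 - 48 * exp 1 + 24 = 24 * ((exp 1)\<^sup>2 - 2 * exp 1 + 1 :: real)"
    by simp
  show "const_p0 = (const_A + const_B) / 2"
    unfolding const_p0_def const_A_def const_B_def D'
    using D by (simp add: divide_simps)
  show "const_d0 = (const_B - const_A) / 2"
    unfolding const_d0_def const_A_def const_B_def D'
    using D by (simp add: divide_simps)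
qed

text \<open>
  The tightest constraint is \<open>const_d0 < 0.0020035\<close>, which holds with a margin of about
  \<open>4 * 10 ^ - 8\<close>; twelve terms of the exponential series determine \<open>exp 1\<close> well within that.
\<close>

lemma exp_1_bounds: "2.71828182 \<le> exp (1::real)" "exp (1::real) \<le> 2.71828184"
proof -
  obtain t :: real where t: "\<bar>t\<bar> \<le> \<bar>1\<bar>"
    "exp 1 = (\<Sum>m<12. 1 ^ m / fact m) + exp t / fact 12 * 1 ^ 12"
    using Maclaurin_exp_le[of 1 12] by blast
  have "exp t \<le> exp 1" using t(1) by simp
  also have "\<dots> \<le> (3::real)" by (rule exp_le)
  finally have "exp t \<le> 3" .
  have "exp t > 0" by simp
  \<comment> \<open>The sum over \<open>m < 12\<close> has the common denominator \<open>11! = 39916800\<close>, and \<open>12! = 479001600\<close>.\<close>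
  have "exp (1::real) = 108505112 / 39916800 + exp t / 479001600"
    using t(2) by (simp add: eval_nat_numeral fact_numeral)
  with \<open>exp t \<le> 3\<close> \<open>exp t > 0\<close>
  have lower: "108505112 / 39916800 \<le> exp (1::real)"
    and upper: "exp (1::real) \<le> 108505112 / 39916800 + 3 / 479001600"
    by simp_all
  show "2.71828182 \<le> exp (1::real)"
    by (rule order_trans[OF _ lower]) simp
  show "exp (1::real) \<le> 2.71828184"
    by (rule order_trans[OF upper]) simp
qed

text \<open>
  The bounds are sharp enough that, by \<open>midpoint\<close>, all decimal expansions of \<open>p\<^sub>0\<close> and \<open>d\<^sub>0\<close> follow
  from them by linear arithmetic.
\<close>

lemma const_A_bounds: "0.07932635 \<le> const_A" "const_A \<le> 0.0793265"
proof -
  define e where "e = exp (1::real)"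
  have e: "2.71828182 \<le> e" "e \<le> 2.71828184" using exp_1_bounds by (auto simp: e_def)
  have lo: "1.71828182\<^sup>2 \<le> (e - 1)\<^sup>2" and hi: "(e - 1)\<^sup>2 \<le> 1.71828184\<^sup>2"
    using e by (intro power_mono; simp)+
  have pos: "(e - 1)\<^sup>2 > 0" using e by simp
  have "e \<le> (1 - 0.07932635) * 1.71828182\<^sup>2" "(1 - 0.0793265) * 1.71828184\<^sup>2 \<le> e"
    using e by (simp_all add: power2_eq_square)
  with lo hi have "e \<le> (1 - 0.07932635) * (e - 1)\<^sup>2" "(1 - 0.0793265) * (e - 1)\<^sup>2 \<le> e"
    by (simp_all add: power2_eq_square)
  then have "e / (e - 1)\<^sup>2 \<le> 1 - 0.07932635" "1 - 0.0793265 \<le> e / (e - 1)\<^sup>2"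
    using pos by (simp_all add: pos_divide_le_eq pos_le_divide_eq)
  then show "0.07932635 \<le> const_A" "const_A \<le> 0.0793265"
    unfolding const_A_alt e_def[symmetric] by linarith+
qed

text \<open>
  On the unit interval \<open>phi p\<close> stays between its two boundary limits and approaches both of them.
\<close>

lemma sup_dev_phi: "sup_dev phi 0 1 p = ereal (max \<bar>const_B - p\<bar> \<bar>const_A - p\<bar>)"
proof (rule antisym)
  show "sup_dev phi 0 1 p \<le> ereal (max \<bar>const_B - p\<bar> \<bar>const_A - p\<bar>)"
    unfolding sup_dev_def
  proof (rule SUP_least)
    fix x :: real
    assume x: "x \<in> {0<..<1}"
    show "ereal \<bar>phi p x\<bar> \<le> ereal (max \<bar>const_B - p\<bar> \<bar>const_A - p\<bar>)"
      using phi_gt_at_1[OF x, of p] phi_lt_at_0[of x p] x by (simp add: max_def abs_if)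
  qed
  have bound: "ereal \<bar>l\<bar> \<le> sup_dev phi 0 1 p"
    if "(phi p \<longlongrightarrow> l) F" "F \<noteq> bot" "eventually (\<lambda>x. x \<in> {0<..<1}) F" for l F
  proof (rule tendsto_upperbound)
    show "((\<lambda>x. ereal \<bar>phi p x\<bar>) \<longlongrightarrow> ereal \<bar>l\<bar>) F"
      using that(1) by (intro tendsto_intros)
    show "eventually (\<lambda>x. ereal \<bar>phi p x\<bar> \<le> sup_dev phi 0 1 p) F"
      using that(3) unfolding sup_dev_def by eventually_elim (rule SUP_upper)
  qed (use that in auto)
  have "ereal \<bar>const_B - p\<bar> \<le> sup_dev phi 0 1 p"
    by (rule bound[OF phi_tendsto_0 _ eventually_at_right_real]) simp_all
  moreover have "ereal \<bar>const_A - p\<bar> \<le> sup_dev phi 0 1 p"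
    by (rule bound[OF phi_tendsto_1 _ eventually_at_left_real]) simp_all
  ultimately show "ereal (max \<bar>const_B - p\<bar> \<bar>const_A - p\<bar>) \<le> sup_dev phi 0 1 p"
    by (simp add: max_def)
qed

lemma sup_dev_phi_ge: "ereal const_d0 \<le> sup_dev phi 0 1 p"
  unfolding sup_dev_phi midpoint by (simp add: max_def abs_if)

lemma sup_dev_phi_eq_iff: "sup_dev phi 0 1 p = ereal const_d0 \<longleftrightarrow> p = const_p0"
  using const_A_bounds unfolding sup_dev_phi midpoint const_B_def
  by (auto simp: max_def abs_if field_simps)

lemma inf_sup_dev_phi: "inf_sup_dev phi 0 1 = ereal const_d0"
proof (rule antisym)
  have "const_p0 > 0" using const_A_bounds by (simp add: midpoint const_B_def)
  then have "inf_sup_dev phi 0 1 \<le> sup_dev phi 0 1 const_p0"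
    unfolding inf_sup_dev_def by (intro INF_lower) simp
  then show "inf_sup_dev phi 0 1 \<le> ereal const_d0"
    by (simp only: iffD2[OF sup_dev_phi_eq_iff refl])
  show "ereal const_d0 \<le> inf_sup_dev phi 0 1"
    unfolding inf_sup_dev_def by (intro INF_greatest sup_dev_phi_ge)
qed

lemma minimax_parameter_phi: "is_minimax_parameter phi 0 1 const_p0"
  unfolding is_minimax_parameter_def inf_sup_dev_phi sup_dev_phi_eq_iff
  using const_A_bounds by (simp add: midpoint const_B_def)

theorem mainTheorem2:
  shows
    "(0.079326 \<le> const_A \<and> const_A < 0.079327 \<and>
      0.083333 \<le> const_B \<and> const_B < 0.083334 \<and>
      0.081329 \<le> const_p0 \<and> const_p0 < 0.081330 \<and>
      0.0020034 \<le> const_d0 \<and> const_d0 < 0.0020035) \<and>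
    (\<forall>p\<in>{0<..const_A}. \<forall>x\<in>{0<..<1}.
        exp (- x) / (1 - exp (- x))\<^sup>2 < 1 / x\<^sup>2 - const_A \<and> 1 / x\<^sup>2 - const_A \<le> 1 / x\<^sup>2 - p) \<and>
    (\<forall>p\<in>{const_A<..<const_B}.
        (\<exists>!x. x \<in> {0<..<1} \<and> phi p x = 0) \<and>
        (\<forall>x\<^sub>0\<in>{0<..<1}. phi p x\<^sub>0 = 0 \<longrightarrow>
           (\<forall>x\<in>{0<..<x\<^sub>0}. exp (- x) / (1 - exp (- x))\<^sup>2 < 1 / x\<^sup>2 - p) \<and>
           (\<forall>x\<in>{x\<^sub>0<..<1}. exp (- x) / (1 - exp (- x))\<^sup>2 > 1 / x\<^sup>2 - p))) \<and>
    (\<forall>p\<in>{const_B..}. \<forall>x\<in>{0<..<1}.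
        exp (- x) / (1 - exp (- x))\<^sup>2 > 1 / x\<^sup>2 - const_B \<and> 1 / x\<^sup>2 - const_B \<ge> 1 / x\<^sup>2 - p) \<and>
    (\<forall>p>0. (\<exists>l. (phi p \<longlongrightarrow> l) (at_right 0)) \<and> (\<exists>l. (phi p \<longlongrightarrow> l) (at_left 1))) \<and>
    ({p \<in> {const_A<..<const_B}. Lim (at_right 0) (phi p) = - Lim (at_left 1) (phi p)} = {const_p0}
      \<and> const_d0 = Lim (at_right 0) (phi const_p0)
      \<and> const_d0 = \<bar>Lim (at_left 1) (phi const_p0)\<bar>
      \<and> ereal const_d0 = (INF p\<in>{0<..}. SUP x\<in>{0<..<1}. ereal \<bar>phi p x\<bar>)) \<and>
    (is_minimax_parameter phi 0 1 const_p0
      \<and> is_minimax_approximant phi 0 1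
          (\<lambda>x. 1 / x\<^sup>2 - exp (- x) / (1 - exp (- x))\<^sup>2
               - (13 * (exp 1)\<^sup>2 - 38 * exp 1 + 13) / (24 * (exp 1)\<^sup>2 - 48 * exp 1 + 24)))"
proof (intro conjI)
  show "0.079326 \<le> const_A" "const_A < 0.079327"
    "0.081329 \<le> const_p0" "const_p0 < 0.081330"
    "0.0020034 \<le> const_d0" "const_d0 < 0.0020035"
    using const_A_bounds by (simp_all add: midpoint const_B_def)
  show "0.083333 \<le> const_B" "const_B < 0.083334"
    by (simp_all add: const_B_def)
  have A_less_B: "const_A < const_B"
    using const_A_bounds by (simp add: const_B_def)
  show "\<forall>p\<in>{0<..const_A}. \<forall>x\<in>{0<..<1}.
      exp (- x) / (1 - exp (- x))\<^sup>2 < 1 / x\<^sup>2 - const_A \<and> 1 / x\<^sup>2 - const_A \<le> 1 / x\<^sup>2 - p"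
    using phi_gt_at_1[where p = 0] by (force simp: phi_def)
  show "\<forall>p\<in>{const_B..}. \<forall>x\<in>{0<..<1}.
      exp (- x) / (1 - exp (- x))\<^sup>2 > 1 / x\<^sup>2 - const_B \<and> 1 / x\<^sup>2 - const_B \<ge> 1 / x\<^sup>2 - p"
    using phi_lt_at_0[where p = 0] by (force simp: phi_def)
  show "\<forall>p\<in>{const_A<..<const_B}.
      (\<exists>!x. x \<in> {0<..<1} \<and> phi p x = 0) \<and>
      (\<forall>x\<^sub>0\<in>{0<..<1}. phi p x\<^sub>0 = 0 \<longrightarrow>
         (\<forall>x\<in>{0<..<x\<^sub>0}. exp (- x) / (1 - exp (- x))\<^sup>2 < 1 / x\<^sup>2 - p) \<and>
         (\<forall>x\<in>{x\<^sub>0<..<1}. exp (- x) / (1 - exp (- x))\<^sup>2 > 1 / x\<^sup>2 - p))"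
  proof (intro ballI conjI impI)
    fix p assume "p \<in> {const_A<..<const_B}"
    then show "\<exists>!x. x \<in> {0<..<1} \<and> phi p x = 0" by (rule phi_unique_zero)
  next
    fix p x\<^sub>0 x :: real
    assume "phi p x\<^sub>0 = 0" "x \<in> {0<..<x\<^sub>0}"
    then show "exp (- x) / (1 - exp (- x))\<^sup>2 < 1 / x\<^sup>2 - p"
      using phi_strict_antimono[of x x\<^sub>0 p] by (simp add: phi_def[of p x])
  next
    fix p x\<^sub>0 x :: real
    assume "x\<^sub>0 \<in> {0<..<1}" "phi p x\<^sub>0 = 0" "x \<in> {x\<^sub>0<..<1}"
    then show "exp (- x) / (1 - exp (- x))\<^sup>2 > 1 / x\<^sup>2 - p"
      using phi_strict_antimono[of x\<^sub>0 x p] by (simp add: phi_def[of p x])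
  qed
  show "\<forall>p>0. (\<exists>l. (phi p \<longlongrightarrow> l) (at_right 0)) \<and> (\<exists>l. (phi p \<longlongrightarrow> l) (at_left 1))"
    using phi_tendsto_0 phi_tendsto_1 by blast
  have Lim_0: "Lim (at_right 0) (phi p) = const_B - p" for p
    by (rule tendsto_Lim[OF _ phi_tendsto_0]) simp
  have Lim_1: "Lim (at_left 1) (phi p) = const_A - p" for p
    by (rule tendsto_Lim[OF _ phi_tendsto_1]) simp
  show "{p \<in> {const_A<..<const_B}. Lim (at_right 0) (phi p) = - Lim (at_left 1) (phi p)}
      = {const_p0}"
    using A_less_B by (auto simp: Lim_0 Lim_1 midpoint field_simps)
  show "const_d0 = Lim (at_right 0) (phi const_p0)"
    by (simp add: Lim_0 midpoint field_simps)
  show "const_d0 = \<bar>Lim (at_left 1) (phi const_p0)\<bar>"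
    using A_less_B by (simp add: Lim_1 midpoint field_simps)
  show "ereal const_d0 = (INF p\<in>{0<..}. SUP x\<in>{0<..<1}. ereal \<bar>phi p x\<bar>)"
    using inf_sup_dev_phi by (simp add: inf_sup_dev_def sup_dev_def)
  show "is_minimax_parameter phi 0 1 const_p0" by (rule minimax_parameter_phi)
  then show "is_minimax_approximant phi 0 1
      (\<lambda>x. 1 / x\<^sup>2 - exp (- x) / (1 - exp (- x))\<^sup>2
           - (13 * (exp 1)\<^sup>2 - 38 * exp 1 + 13) / (24 * (exp 1)\<^sup>2 - 48 * exp 1 + 24))"
    unfolding is_minimax_approximant_def
    by (intro exI[of _ const_p0] conjI) (simp_all add: phi_def const_p0_def)
qed

end
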